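(* Let $G$ be a finite group and let $k \geq 1$ be an integer. Let $\Gamma(G)$ be the common divisor graph on the set of sizes of noncentral conjugacy classes of $G$. Assume that $\Gamma(G)$ is a $k$-regular graph. Then $\Gamma(G)$ is a complete graph with $k+1$ vertices.
   Context: For a finite group $G$, $\Gamma(G)$ denotes the simple undirected graph whose vertices are the distinct sizes of noncentral conjugacy classes of $G$ (i.e. the distinct integers $|g^G|$ with $g \in G$ not in the centre of $G$, where $g^G$ is the conjugacy class of $g$ in $G$); two distinct vertices are adjacent if and only if they are not coprime as integers. A graph is $k$-regular if every vertex has exactly $k$ neighbours; the graph with no vertices is not regarded as $k$-regular for $k\geq 1$. *)

theory Defs
  imports "HOL-Algebra.Group_Action" "Graph_Theory.Kuratowski"
begin

definition center :: "('a, 'b) monoid_scheme \<Rightarrow> 'a set" where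
  "center G = {z \<in> carrier G. \<forall>x \<in> carrier G. z \<otimes>\<^bsub>G\<^esub> x = x \<otimes>\<^bsub>G\<^esub> z}"

definition conj_class :: "('a, 'b) monoid_scheme \<Rightarrow> 'a \<Rightarrow> 'a set" where
  "conj_class G g = {inv\<^bsub>G\<^esub> h \<otimes>\<^bsub>G\<^esub> g \<otimes>\<^bsub>G\<^esub> h | h. h \<in> carrier G}"

definition noncentral_class_sizes :: "('a, 'b) monoid_scheme \<Rightarrow> nat set" where
  "noncentral_class_sizes G = {card (conj_class G g) | g. g \<in> carrier G - center G}"

text \<open>An undirected simple graph is represented, as in \<^theory>\<open>Graph_Theory.Digraph\<close>, by a
  symmetric loop-free digraph: each undirected edge appears as a pair of opposite arcs.\<close>

definition common_divisor_graph :: "('a, 'b) monoid_scheme \<Rightarrow> nat pair_pre_digraph" where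
  "common_divisor_graph G =
     \<lparr>pverts = noncentral_class_sizes G,
      parcs = {(m, n). m \<in> noncentral_class_sizes G \<and> n \<in> noncentral_class_sizes G
                 \<and> m \<noteq> n \<and> \<not> coprime m n}\<rparr>"

text \<open>The library's notion of graph admits the graph without vertices, which is not
  counted as regular. As a graph has no multiple arcs, \<^const>\<open>out_degree\<close> counts neighbours.\<close>

definition regular_graph :: "nat \<Rightarrow> ('a, 'b) pre_digraph \<Rightarrow> bool" where
  "regular_graph k \<Gamma> \<longleftrightarrow>
     graph \<Gamma> \<and> verts \<Gamma> \<noteq> {} \<and> (\<forall>v \<in> verts \<Gamma>. out_degree \<Gamma> v = k)"

lemma graph_common_divisor_graph:
  assumes "finite (carrier G)"
  shows "graph (with_proj (common_divisor_graph G))"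
proof -
  let ?V = "noncentral_class_sizes G"
  have V: "finite ?V"
    using assms by (simp add: noncentral_class_sizes_def)
  have "parcs (common_divisor_graph G) \<subseteq> ?V \<times> ?V"
    by (auto simp: common_divisor_graph_def)
  then have E: "finite (parcs (common_divisor_graph G))"
    using V by (meson finite_SigmaI finite_subset)
  show ?thesis
    using V E
    by unfold_locales
       (auto simp: common_divisor_graph_def arc_to_ends_def symmetric_def arcs_ends_def sym_def
          coprime_commute)
qed

lemma conj_class_eq_orbit:
  assumes "group G" "g \<in> carrier G"
  shows "conj_class G g =
    Group_Action.orbit G (\<lambda>h. \<lambda>x \<in> carrier G. h \<otimes>\<^bsub>G\<^esub> x \<otimes>\<^bsub>G\<^esub> inv\<^bsub>G\<^esub> h) g"
proof -
  interpret group G by fact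
  show ?thesis
    using assms(2) unfolding conj_class_def Group_Action.orbit_def
    by (auto; metis inv_closed inv_inv)
qed

end

theory Submission
  imports Defs "HOL-Algebra.Sylow" "HOL-Algebra.Multiplicative_Group" "HOL-Number_Theory.Cong"
begin

text \<open>
  For a class size \<open>u\<close> let \<open>N(u)\<close> be its closed neighbourhood, the set of the class sizes not
  coprime to \<open>u\<close>, and call two noncentral elements twins if the sizes of their classes have the
  same closed neighbourhood. If \<open>u\<close> divides \<open>w\<close>, then \<open>N(u) \<subseteq> N(w)\<close>, and in a regular graph
  this forces \<open>N(u) = N(w)\<close>. Hence elements with nested centralizers are twins, and so are
  commuting noncentral elements \<open>x\<close>, \<open>y\<close> of prime power orders for different primes, because the
  centralizer of \<open>xy\<close> lies in those of \<open>x\<close> and \<open>y\<close>. Every noncentral element is a twin of an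
  element of prime power order. Moreover, a \<open>p\<close>-element \<open>x\<close> acts by conjugation on the class of
  \<open>y\<close> and has a fixed point there unless \<open>p\<close> divides the class size of \<open>y\<close>. So if \<open>x\<close> is a
  \<open>p\<close>-element and \<open>y\<close> a \<open>q\<close>-element with \<open>p \<noteq> q\<close>, both noncentral, which are not twins, then
  \<open>p\<close> divides the class size of \<open>y\<close> (\<open>prime_dvd_class_size\<close>). All further steps use only these
  facts and the observation that a prime dividing \<open>|C(x) : Z|\<close>, where \<open>Z\<close> is the centre, is the
  prime of some noncentral element of prime power order in \<open>C(x)\<close>.

  Suppose that two class sizes are coprime. Then there are a noncentral \<open>p\<close>-element \<open>c\<close> and a
  noncentral \<open>q\<close>-element \<open>d\<close> with coprime class sizes and \<open>p \<noteq> q\<close>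
  (\<open>class_sizes_not_coprime\<close>). The prime \<open>p\<close> divides the class size of \<open>d\<close> and \<open>q\<close> that of
  \<open>c\<close>, and every noncentral element whose order is a power of a third prime is a twin of
  \<open>c\<close> or of \<open>d\<close>.

  Every noncentral element is a twin of \<open>c\<close> or of \<open>d\<close> (\<open>no_stray\<close>): for an element \<open>x\<close> that is
  neither, \<open>|C(x) : Z|\<close> has no prime divisors besides \<open>p\<close> and \<open>q\<close>, while comparing \<open>N\<close> at \<open>x\<close>
  with \<open>N\<close> at \<open>c\<close> and at \<open>d\<close> shows that the class size of \<open>x\<close> is prime to \<open>pq\<close>. These two
  properties determine the class size of \<open>x\<close> as a divisor of \<open>|G : Z|\<close>, and it turns out to be
  an isolated vertex, contrary to \<open>k \<ge> 1\<close>.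

  So the graph consists of two disjoint complete graphs, the class sizes of the twins of \<open>c\<close> and
  those of the twins of \<open>d\<close>, each with \<open>k + 1 \<ge> 2\<close> vertices. If no \<open>q\<close>-element were a twin of
  \<open>c\<close>, then for twins \<open>x\<close>, \<open>y\<close> of \<open>c\<close> the class size of \<open>x\<close> would be coprime to
  \<open>|C(y) : Z|\<close>, which makes all these class sizes equal (\<open>q_element_twin_c\<close>). Hence some
  \<open>q\<close>-element is a twin of \<open>c\<close>, and by symmetry some \<open>p\<close>-element is a twin of \<open>d\<close>. As these
  two are not twins, \<open>p\<close> divides the size of a class of a twin of \<open>c\<close>, but it also divides the
  class size of \<open>d\<close>, a contradiction.
\<close>

section \<open>Centralizers and class sizes in a finite group\<close>

lemma card_one_unique: "card S = 1 \<Longrightarrow> a \<in> S \<Longrightarrow> b \<in> S \<Longrightarrow> a = b"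
  by (metis card_1_singletonE singletonD)

locale finite_group = group G for G (structure) +
  assumes fin: "finite (carrier G)"
begin

text \<open>The centralizer of a single element.\<close>

definition centralizer :: "'a \<Rightarrow> 'a set" where
  "centralizer x = {g \<in> carrier G. g \<otimes> x = x \<otimes> g}"

text \<open>The set of elements outside the centre.\<close>

definition noncentral :: "'a set" where
  "noncentral = carrier G - center G"

definition class_size :: "'a \<Rightarrow> nat" where
  "class_size x = card (conj_class G x)"

text \<open>Elements of \<open>p\<close>-power order; the identity is one for every \<open>p\<close>.\<close>

definition p_element :: "nat \<Rightarrow> 'a \<Rightarrow> bool" where
  "p_element p x \<longleftrightarrow> x \<in> carrier G \<and> (\<exists>n. x [^] (p ^ n) = \<one>)"

lemma noncentral_carrier: "x \<in> noncentral \<Longrightarrow> x \<in> carrier G"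
  by (simp add: noncentral_def)

lemma centralizer_iff: "y \<in> centralizer x \<longleftrightarrow> y \<in> carrier G \<and> y \<otimes> x = x \<otimes> y"
  by (simp add: centralizer_def)

lemma centralizer_sym: "x \<in> carrier G \<Longrightarrow> y \<in> centralizer x \<Longrightarrow> x \<in> centralizer y"
  unfolding centralizer_iff by metis

lemma noncentral_iff:
  assumes "x \<in> carrier G"
  shows "x \<in> noncentral \<longleftrightarrow> centralizer x \<noteq> carrier G"
proof -
  have "x \<in> center G \<longleftrightarrow> (\<forall>g\<in>carrier G. g \<in> centralizer x)"
    unfolding center_def centralizer_iff using assms by (simp add: eq_commute)
  moreover have "centralizer x \<subseteq> carrier G" by (auto simp: centralizer_iff)
  ultimately show ?thesis using assms by (auto simp: noncentral_def)
qed

lemma centralizer_eq_stabilizer: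
  assumes "x \<in> carrier G"
  shows "centralizer x = stabilizer G (\<lambda>h. \<lambda>y \<in> carrier G. h \<otimes> y \<otimes> inv h) x"
proof (rule Set.set_eqI)
  fix h
  show "h \<in> centralizer x \<longleftrightarrow>
    h \<in> stabilizer G (\<lambda>h. \<lambda>y \<in> carrier G. h \<otimes> y \<otimes> inv h) x"
    unfolding centralizer_iff stabilizer_def using assms
    by (cases "h \<in> carrier G") (simp_all add: inv_solve_right')
qed

lemma subgroup_centralizer: "x \<in> carrier G \<Longrightarrow> subgroup (centralizer x) G"
  using group_action.stabilizer_subgroup[OF action_by_conjugation]
  by (simp add: centralizer_eq_stabilizer)

lemma class_size_mult_centralizer:
  assumes "x \<in> carrier G"
  shows "class_size x * card (centralizer x) = order G"
  unfolding class_size_def conj_class_eq_orbit[OF is_group assms]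
    centralizer_eq_stabilizer[OF assms]
  by (rule group_action.orbit_stabilizer_theorem[OF action_by_conjugation assms])

lemma center_iff: "x \<in> center G \<longleftrightarrow> x \<in> carrier G \<and> (\<forall>g\<in>carrier G. x \<in> centralizer g)"
  unfolding center_def centralizer_iff by blast

lemma subgroup_center: "subgroup (center G) G"
proof -
  have "\<one> \<in> center G"
    using subgroup_centralizer by (auto simp: center_iff subgroup.one_closed)
  then have "center G \<noteq> {}" by blast
  then show ?thesis
    by (intro subgroupI) (use subgroup_centralizer in \<open>auto simp: center_iff
      subgroup.m_closed subgroup.m_inv_closed\<close>)
qed

lemma center_subset_centralizer: "x \<in> carrier G \<Longrightarrow> center G \<subseteq> centralizer x"
  by (auto simp: center_iff)

lemma card_subgroup_dvd:
  assumes "subgroup H G" "subgroup K G" "H \<subseteq> K"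
  shows "card H dvd card K"
proof -
  have "subgroup H (G\<lparr>carrier := K\<rparr>)"
    using assms subgroup_incl by blast
  then have "card (rcosets\<^bsub>G\<lparr>carrier := K\<rparr>\<^esub> H) * card H = card K"
    using group.lagrange[OF subgroup.subgroup_is_group[OF assms(2) is_group], of H]
    by (simp add: order_def)
  then show ?thesis by (metis dvd_triv_right)
qed

lemma card_subgroup_pos: "subgroup H G \<Longrightarrow> card H > 0"
  using subgroup.finite_imp_card_positive fin by blast

lemma class_size_dvd:
  assumes "x \<in> carrier G" "z \<in> carrier G" "centralizer x \<subseteq> centralizer z"
  shows "class_size z dvd class_size x"
proof -
  obtain t where t: "card (centralizer z) = card (centralizer x) * t"
    using card_subgroup_dvd[OF subgroup_centralizer subgroup_centralizer] assms
    by (metis dvdE)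
  have "class_size x * card (centralizer x) = class_size z * t * card (centralizer x)"
    using class_size_mult_centralizer assms(1,2) t by (metis mult.assoc mult.commute)
  moreover have "card (centralizer x) > 0"
    using card_subgroup_pos subgroup_centralizer assms by blast
  ultimately show ?thesis by auto
qed

lemma class_size_noncentral:
  assumes "x \<in> noncentral"
  shows "class_size x > 1"
proof (rule ccontr)
  assume "\<not> class_size x > 1"
  have x: "x \<in> carrier G" using assms noncentral_carrier by blast
  have pos: "order G > 0" using fin by (simp add: order_gt_0_iff_finite)
  have e: "class_size x * card (centralizer x) = order G"
    using class_size_mult_centralizer x by blast
  with pos \<open>\<not> class_size x > 1\<close> have "class_size x = 1"
    by (metis less_one linorder_neqE_nat mult_is_0 not_gr_zero)
  with e have "card (centralizer x) = card (carrier G)" by (simp add: order_def)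
  then have "centralizer x = carrier G"
    using fin by (simp add: card_subset_eq centralizer_def)
  then show False using assms noncentral_iff x by blast
qed

text \<open>The index of the centre.\<close>

definition central_index :: nat where
  "central_index = order G div card (center G)"

text \<open>The index of the centre in the centralizer of \<^term>\<open>x\<close>.\<close>

definition cofactor :: "'a \<Rightarrow> nat" where
  "cofactor x = card (centralizer x) div card (center G)"

lemma class_size_mult_cofactor:
  assumes "x \<in> carrier G"
  shows "class_size x * cofactor x = central_index"
proof -
  have "card (center G) dvd card (centralizer x)"
    using card_subgroup_dvd[OF subgroup_center subgroup_centralizer[OF assms]
        center_subset_centralizer[OF assms]] .
  then show ?thesis
    using class_size_mult_centralizer[OF assms] unfolding central_index_def cofactor_def
    by (metis div_mult_swap)
qed

text \<open>A Sylow \<open>l\<close>-subgroup of the centralizer is not contained in the centre.\<close>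

lemma cofactor_p_element:
  assumes "prime l" "x \<in> carrier G"
    and "l dvd cofactor x"
  obtains z where "z \<in> centralizer x" "z \<in> noncentral" "p_element l z"
proof -
  let ?C = "G\<lparr>carrier := centralizer x\<rparr>"
  have sC: "subgroup (centralizer x) G" using subgroup_centralizer assms by blast
  have gC: "group ?C" using subgroup.subgroup_is_group[OF sC is_group] .
  have finC: "finite (centralizer x)" using fin by (simp add: centralizer_def)
  have zd: "card (center G) dvd card (centralizer x)"
    using card_subgroup_dvd[OF subgroup_center sC center_subset_centralizer] assms by blast
  have pos: "card (centralizer x) > 0" using card_subgroup_pos sC by blast
  define a where "a = multiplicity l (card (centralizer x))"
  obtain m where m: "card (centralizer x) = l ^ a * m"
    using multiplicity_dvd[of l "card (centralizer x)"] unfolding a_def by blast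
  obtain P where P: "subgroup P ?C" "card P = l ^ a"
    using sylow_thm[OF assms(1) gC, of a m] m finC by (auto simp: order_def)
  have sP: "subgroup P G" using P(1) sC incl_subgroup by blast
  have PC: "P \<subseteq> centralizer x" using subgroup.subset[OF P(1)] by simp
  have elP: "p_element l z" if "z \<in> P" for z
  proof -
    have zc: "z \<in> carrier G" using that sP subgroup.subset by blast
    have "z [^]\<^bsub>G\<lparr>carrier := P\<rparr>\<^esub> order (G\<lparr>carrier := P\<rparr>) = \<one>\<^bsub>G\<lparr>carrier := P\<rparr>\<^esub>"
      using group.pow_order_eq_1[OF subgroup.subgroup_is_group[OF sP is_group]] that by simp
    then have "z [^] card P = \<one>"
      by (simp add: order_def nat_pow_consistent[symmetric])
    then show ?thesis using zc P(2) by (auto simp: p_element_def)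
  qed
  have "\<not> P \<subseteq> center G"
  proof
    assume "P \<subseteq> center G"
    then have "l ^ a dvd card (center G)"
      using card_subgroup_dvd[OF sP subgroup_center] P(2) by simp
    then have "l ^ a * l dvd card (center G) * (card (centralizer x) div card (center G))"
      using assms(3) unfolding cofactor_def by (rule mult_dvd_mono)
    then have "l ^ Suc a dvd card (centralizer x)" using zd by (simp add: mult.commute)
    then show False using assms(1) pos unfolding a_def
      by (metis multiplicity_geI not_prime_unit less_irrefl not_less_eq_eq order_refl less_imp_neq
          nat_neq_iff)
  qed
  then obtain z where "z \<in> P" "z \<notin> center G" by blast
  then show thesis
    using that[of z] PC elP by (auto simp: noncentral_def p_element_def)
qed

lemma centralizer_pow_mono:
  assumes "x \<in> carrier G"
  shows "centralizer x \<subseteq> centralizer (x [^] (n::nat))"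
proof
  fix g assume "g \<in> centralizer x"
  then have g: "x \<in> centralizer g" "g \<in> carrier G"
    using centralizer_sym assms by (auto simp: centralizer_def)
  have "x [^] n \<in> centralizer g"
    by (induction n) (use g subgroup_centralizer[of g] in
      \<open>auto simp: subgroup.one_closed subgroup.m_closed\<close>)
  then show "g \<in> centralizer (x [^] n)" using g by (simp add: centralizer_def)
qed

lemma pow_cong_eq:
  assumes "x \<in> carrier G" "x [^] (n::nat) = \<one>" "[i = j] (mod n)"
  shows "x [^] i = x [^] j"
proof -
  have "x [^] i = x [^] (i mod n)" for i
  proof -
    have "x [^] i = x [^] (n * (i div n) + i mod n)" by simp
    also have "\<dots> = (x [^] n) [^] (i div n) \<otimes> x [^] (i mod n)"
      using assms(1) by (simp only: nat_pow_mult[symmetric] nat_pow_pow[symmetric] nat_pow_closed)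
    also have "\<dots> = x [^] (i mod n)" using assms by simp
    finally show ?thesis .
  qed
  then show ?thesis using assms(3) by (metis cong_def)
qed

text \<open>
  If \<open>x\<^sup>n = 1\<close> and \<open>n = ab\<close> with \<open>a\<close>, \<open>b\<close> coprime, then \<open>x\<close> is a product of powers of
  \<open>x\<^sup>a\<close> and \<open>x\<^sup>b\<close>, so one of these is noncentral; it is centralized by everything
  that centralizes \<open>x\<close>.
\<close>

lemma noncentral_primary_part_aux:
  assumes "x [^] (n::nat) = \<one>" "n > 0" "x \<in> noncentral"
  shows "\<exists>p z. prime p \<and> p_element p z \<and> z \<in> noncentral \<and> centralizer x \<subseteq> centralizer z"
  using assms
proof (induction n arbitrary: x rule: less_induct)
  case (less n)
  have x: "x \<in> carrier G" using less.prems noncentral_carrier by blast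
  have "n \<noteq> 1"
  proof
    assume "n = 1"
    then have "x = \<one>" using less.prems x by simp
    then show False using less.prems subgroup.one_closed[OF subgroup_center]
      by (simp add: noncentral_def)
  qed
  then obtain p where p: "prime p" "p dvd n" using prime_factor_nat by blast
  define a where "a = p ^ multiplicity p n"
  obtain b where n: "n = a * b" "\<not> p dvd b"
    using multiplicity_decompose'[of n p] less.prems p unfolding a_def
    by (metis not_prime_unit not_gr_zero)
  have a1: "a > 1" using p less.prems unfolding a_def
    by (metis One_nat_def less_irrefl multiplicity_eq_zero_iff nat_neq_iff not_prime_unit
        one_less_power prime_gt_1_nat not_gr_zero)
  have cop: "coprime a b" unfolding a_def
    using n(2) p(1) by (simp add: prime_imp_coprime)
  show ?case
  proof (cases "b = 1")
    case True
    then have "n = p ^ multiplicity p n" using n(1) by (simp add: a_def)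
    then have "p_element p x" using less.prems x unfolding p_element_def by metis
    then show ?thesis using p less.prems by blast
  next
    case False
    have b0: "b > 0" using n less.prems by (cases b) auto
    have IH: ?thesis if "x [^] c \<in> noncentral" "(x [^] c) [^] d = \<one>" "d < n" "d > 0" for c d :: nat
      using less.IH[OF that(3) that(2) that(4) that(1)] centralizer_pow_mono[OF x, of c] by blast
    have pa: "(x [^] a) [^] b = \<one>" "(x [^] b) [^] a = \<one>"
      using less.prems n x by (simp_all add: nat_pow_pow mult.commute)
    have "x [^] a \<in> noncentral \<or> x [^] b \<in> noncentral"
    proof (rule ccontr)
      assume "\<not> ?thesis"
      then have c: "x [^] a \<in> center G" "x [^] b \<in> center G"
        using x by (auto simp: noncentral_def)
      obtain j where j: "[j = 0] (mod a)" "[j = 1] (mod b)"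
        using binary_chinese_remainder_nat[OF cop] by blast
      obtain i where i: "[i = 1] (mod a)" "[i = 0] (mod b)"
        using binary_chinese_remainder_nat[OF cop] by blast
      have powc: "y [^] (k::nat) \<in> center G" if "y \<in> center G" for y k
        by (induction k) (use that subgroup_center in
            \<open>auto simp: subgroup.one_closed subgroup.m_closed\<close>)
      have "x [^] i \<in> center G" "x [^] j \<in> center G"
        using powc[OF c(1)] powc[OF c(2)] i(2) j(1) x
        by (auto simp: cong_0_iff nat_pow_pow elim!: dvdE)
      then have "x [^] (i + j) \<in> center G"
        using subgroup.m_closed[OF subgroup_center] x by (simp add: nat_pow_mult[symmetric])
      moreover have "[i + j = 1] (mod n)"
        unfolding n
      proof (rule coprime_cong_mult_nat[OF _ _ cop])
        show "[i + j = 1] (mod a)" using cong_add[OF i(1) j(1)] by simp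
        show "[i + j = 1] (mod b)" using cong_add[OF i(2) j(2)] by simp
      qed
      then have "x [^] (i + j) = x [^] (1::nat)"
        using pow_cong_eq[OF x less.prems(1)] by blast
      ultimately show False using less.prems x by (simp add: noncentral_def)
    qed
    moreover have "b < n" "a < n" using n a1 b0 False by auto
    ultimately show ?thesis using IH[of a b] IH[of b a] pa a1 b0 by auto
  qed
qed

lemma noncentral_primary_part:
  assumes "x \<in> noncentral"
  obtains p z where "prime p" "p_element p z" "z \<in> noncentral" "centralizer x \<subseteq> centralizer z"
proof -
  have "order G > 0" using fin by (simp add: order_gt_0_iff_finite)
  moreover have "x [^] order G = \<one>"
    using pow_order_eq_1 noncentral_carrier[OF assms] .
  ultimately show thesis
    using noncentral_primary_part_aux[of x "order G"] assms that by blast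
qed

text \<open>The factor \<open>x\<close> is a power of the product \<open>xy\<close>.\<close>

lemma centralizer_mult_coprime:
  assumes "prime p" "prime q" "p \<noteq> q" "p_element p x" "p_element q y" "y \<in> centralizer x"
  shows "centralizer (x \<otimes> y) \<subseteq> centralizer x"
proof -
  obtain a b where ab: "x [^] (p ^ a) = \<one>" "y [^] (q ^ b) = \<one>"
    and xy: "x \<in> carrier G" "y \<in> carrier G"
    using assms by (auto simp: p_element_def)
  have "coprime (p ^ a) (q ^ b)"
    using assms by (simp add: primes_coprime)
  then obtain j where j: "[j = 1] (mod p ^ a)" "[j = 0] (mod q ^ b)"
    using binary_chinese_remainder_nat by blast
  have "x \<otimes> y = y \<otimes> x" using assms(6) by (simp add: centralizer_def)
  then have "(x \<otimes> y) [^] j = x [^] j \<otimes> y [^] j"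
    using pow_mult_distrib xy by blast
  also have "\<dots> = x"
    using pow_cong_eq[OF xy(1) ab(1) j(1)] pow_cong_eq[OF xy(2) ab(2) j(2)] xy by simp
  finally show ?thesis
    using centralizer_pow_mono[of "x \<otimes> y" j] xy by simp
qed

text \<open>
  The orbits of the cyclic group generated by \<open>x\<close>, acting by conjugation on the class of \<open>y\<close>,
  have \<open>p\<close>-power lengths, and these lengths cannot all be divisible by \<open>p\<close>.
\<close>

lemma p_element_commutes_with_conjugate:
  assumes "prime p" "p_element p x" "y \<in> carrier G" "\<not> p dvd class_size y"
  obtains y' where "y' \<in> conj_class G y" "y' \<in> centralizer x"
proof -
  let ?\<phi> = "\<lambda>h. \<lambda>y \<in> carrier G. h \<otimes> y \<otimes> inv h"
  let ?E = "conj_class G y"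
  have x: "x \<in> carrier G" using assms by (simp add: p_element_def)
  define K where "K = generate G {x}"
  let ?K = "G\<lparr>carrier := K\<rparr>"
  have sK: "subgroup K G" unfolding K_def using generate_is_subgroup x by blast
  have KG: "K \<subseteq> carrier G" using sK subgroup.subset by blast
  have xK: "x \<in> K" unfolding K_def by (simp add: generate.incl)
  interpret GA: group_action G "carrier G" ?\<phi> by (rule action_by_conjugation)
  interpret KA: group_action ?K "carrier G" ?\<phi>
    using GA.induced_action[OF sK] .
  have ordK: "order ?K dvd p ^ n" if "x [^] (p ^ n) = \<one>" for n
    using that x generate_pow_card[OF x] pow_eq_id[OF x] by (simp add: order_def K_def)
  have E: "?E = Group_Action.orbit G ?\<phi> y" using conj_class_eq_orbit[OF is_group assms(3)] .
  have EG: "?E \<subseteq> carrier G" using assms(3) by (auto simp: conj_class_def)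
  have finE: "finite ?E" using EG fin finite_subset by blast
  have orbE: "Group_Action.orbit ?K ?\<phi> e \<subseteq> ?E" if "e \<in> ?E" for e
  proof
    fix f assume "f \<in> Group_Action.orbit ?K ?\<phi> e"
    then obtain g where "g \<in> K" "f = ?\<phi> g e"
      unfolding Group_Action.orbit_def by force
    then have "f \<in> Group_Action.orbit G ?\<phi> e" "f \<in> carrier G"
      using KG that EG GA.element_image[of g e f] unfolding Group_Action.orbit_def by blast+
    then show "f \<in> ?E"
      using that GA.orbit_trans[of y e f] assms(3) EG unfolding E by blast
  qed
  have "\<exists>e\<in>?E. card (Group_Action.orbit ?K ?\<phi> e) = 1"
  proof (rule ccontr)
    assume no: "\<not> ?thesis"
    let ?O = "(\<lambda>e. Group_Action.orbit ?K ?\<phi> e) ` ?E"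
    have U: "\<Union>?O = ?E"
      using orbE KA.orbit_refl EG by blast
    have "p dvd card (\<Union>?O)"
    proof (rule dvd_partition)
      show "finite (\<Union>?O)" using U finE by simp
      show "\<forall>c\<in>?O. p dvd card c"
      proof
        fix c assume "c \<in> ?O"
        then obtain e where e: "e \<in> ?E" "c = Group_Action.orbit ?K ?\<phi> e" by blast
        have "e \<in> carrier G" using e EG by blast
        then have "card c dvd order ?K"
          unfolding e(2) by (simp flip: KA.orbit_stabilizer_theorem)
        moreover obtain n where "order ?K dvd p ^ n"
          using ordK assms(2) unfolding p_element_def by blast
        ultimately obtain i where i: "card c = p ^ i"
          using divides_primepow_nat[OF assms(1)] dvd_trans by metis
        have "card c \<noteq> 1" using no e by blast
        then show "p dvd card c"
          using i by (cases i) auto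
      qed
      show "\<forall>c1\<in>?O. \<forall>c2\<in>?O. c1 \<noteq> c2 \<longrightarrow> c1 \<inter> c2 = {}"
      proof (intro ballI impI)
        fix c1 c2 assume "c1 \<in> ?O" "c2 \<in> ?O" "c1 \<noteq> c2"
        moreover have "?O \<subseteq> orbits ?K (carrier G) ?\<phi>"
          using EG unfolding orbits_def by blast
        ultimately show "c1 \<inter> c2 = {}"
          using KA.disjoint_union[of c1 c2] by blast
      qed
    qed
    then show False using assms(4) U by (simp add: class_size_def)
  qed
  then obtain e where e: "e \<in> ?E" "card (Group_Action.orbit ?K ?\<phi> e) = 1" by blast
  then have eG: "e \<in> carrier G" using EG by blast
  have "?\<phi> x e \<in> Group_Action.orbit ?K ?\<phi> e"
    using xK unfolding Group_Action.orbit_def by auto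
  moreover have "e \<in> Group_Action.orbit ?K ?\<phi> e" using KA.orbit_refl eG by blast
  ultimately have "?\<phi> x e = e"
    using card_one_unique[OF e(2)] by blast
  then have "x \<otimes> e = e \<otimes> x"
    using eG x by (simp add: inv_solve_right')
  then have "e \<in> centralizer x"
    using eG by (simp add: centralizer_iff)
  then show thesis using that e by blast
qed

lemma conj_class_memD:
  assumes "y \<in> carrier G" "y' \<in> conj_class G y"
  shows "y' \<in> carrier G" "class_size y' = class_size y"
    "p_element q y \<Longrightarrow> p_element q y'"
proof -
  interpret GA: group_action G "carrier G" "\<lambda>h. \<lambda>y \<in> carrier G. h \<otimes> y \<otimes> inv h"
    by (rule action_by_conjugation)
  obtain h where h: "h \<in> carrier G" "y' = inv h \<otimes> y \<otimes> h"
    using assms by (auto simp: conj_class_def)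
  show c: "y' \<in> carrier G" using h assms by simp
  have "conj_class G y' = conj_class G y"
    using GA.disjoint_union[of "conj_class G y" "conj_class G y'"] assms c
      GA.orbit_refl[OF c] conj_class_eq_orbit[OF is_group] by (auto simp: orbits_def)
  then show "class_size y' = class_size y" by (simp add: class_size_def)
  have pw: "y' [^] (n::nat) = inv h \<otimes> y [^] n \<otimes> h" for n
  proof (induction n)
    case (Suc n)
    have "y' [^] Suc n = (inv h \<otimes> y [^] n \<otimes> h) \<otimes> (inv h \<otimes> y \<otimes> h)"
      using Suc h by simp
    also have "\<dots> = inv h \<otimes> y [^] Suc n \<otimes> h"
      using h(1) assms(1) by (simp add: m_assoc inv_solve_left flip: m_assoc[of h "inv h"])
    finally show ?case .
  qed (use h in simp)
  show "p_element q y'" if "p_element q y"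
    using that c pw h(1) by (auto simp: p_element_def) (metis l_inv r_one inv_closed)
qed

lemma noncentral_iff_class_size:
  assumes "x \<in> carrier G"
  shows "x \<in> noncentral \<longleftrightarrow> class_size x \<noteq> 1"
proof
  show "x \<in> noncentral \<Longrightarrow> class_size x \<noteq> 1" using class_size_noncentral by fastforce
  show "x \<in> noncentral" if "class_size x \<noteq> 1"
  proof (rule ccontr)
    assume "x \<notin> noncentral"
    then have "centralizer x = carrier G" using noncentral_iff assms by blast
    then have "class_size x * order G = order G"
      using class_size_mult_centralizer[OF assms] by (simp add: order_def)
    moreover have "order G > 0" using fin by (simp add: order_gt_0_iff_finite)
    ultimately show False using that by simp
  qed
qed

end


section \<open>Closed neighbourhoods and twins\<close>

lemma common_prime_factor:
  fixes a b :: nat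
  assumes "\<not> coprime a b"
  obtains s where "prime s" "s dvd a" "s dvd b"
proof -
  have "gcd a b \<noteq> 1" using assms by (simp add: coprime_iff_gcd_eq_1)
  then obtain s where "prime s" "s dvd gcd a b" using prime_factor_nat by blast
  then show thesis using that by simp
qed

lemma coprime_no_common_prime:
  fixes a b :: nat
  shows "coprime a b \<Longrightarrow> prime s \<Longrightarrow> s dvd a \<Longrightarrow> \<not> s dvd b"
  using coprime_common_divisor not_prime_unit by blast

text \<open>
  A finite group whose common divisor graph is \<open>k\<close>-regular, with \<open>k \<ge> 1\<close>. The graph without
  vertices is not excluded here.
\<close>

locale regular_class_graph = finite_group +
  fixes k :: nat
  assumes k_pos: "k \<ge> 1"
    and card_neighbours: "u \<in> noncentral_class_sizes G \<Longrightarrow>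
      card {w \<in> noncentral_class_sizes G. u \<noteq> w \<and> \<not> coprime u w} = k"
begin

abbreviation V :: "nat set" where
  "V \<equiv> noncentral_class_sizes G"

text \<open>The closed neighbourhood of a vertex: as class sizes of noncentral elements exceed 1,
  a vertex is not coprime to itself.\<close>

definition nbhd :: "nat \<Rightarrow> nat set" where
  "nbhd u = {w \<in> V. \<not> coprime u w}"

text \<open>Elements whose class sizes are twins in the graph, that is, have the same closed
  neighbourhood.\<close>

definition twins :: "'a \<Rightarrow> 'a \<Rightarrow> bool" where
  "twins x y \<longleftrightarrow> nbhd (class_size x) = nbhd (class_size y)"

lemma V_eq: "V = class_size ` noncentral"
  by (auto simp: noncentral_class_sizes_def class_size_def noncentral_def)

lemma class_size_in_V: "x \<in> noncentral \<Longrightarrow> class_size x \<in> V"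
  by (simp add: V_eq)

lemma finite_V: "finite V"
  using fin by (simp add: V_eq noncentral_def)

lemma finite_nbhd: "finite (nbhd u)"
  using finite_V by (simp add: nbhd_def)

lemma self_in_nbhd: "u \<in> V \<Longrightarrow> u \<in> nbhd u"
  using class_size_noncentral by (fastforce simp: nbhd_def V_eq)

lemma nbhd_sym: "u \<in> V \<Longrightarrow> w \<in> nbhd u \<Longrightarrow> u \<in> nbhd w"
  by (simp add: nbhd_def coprime_commute)

lemma card_nbhd:
  assumes "u \<in> V"
  shows "card (nbhd u) = k + 1"
proof -
  have "nbhd u = insert u {w \<in> V. u \<noteq> w \<and> \<not> coprime u w}"
    using self_in_nbhd[OF assms] by (auto simp: nbhd_def)
  then show ?thesis using card_neighbours[OF assms] finite_V by simp
qed

text \<open>Here regularity is used: all closed neighbourhoods have the same finite size.\<close>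

lemma nbhd_subset_imp_eq:
  "u \<in> V \<Longrightarrow> w \<in> V \<Longrightarrow> nbhd u \<subseteq> nbhd w \<Longrightarrow> nbhd u = nbhd w"
  using card_subset_eq[OF finite_nbhd] by (simp add: card_nbhd)

lemma nbhd_eq_if_dvd:
  assumes "u \<in> V" "w \<in> V" "u dvd w"
  shows "nbhd u = nbhd w"
proof (rule nbhd_subset_imp_eq[OF assms(1,2)])
  show "nbhd u \<subseteq> nbhd w"
    unfolding nbhd_def using coprime_divisors[OF assms(3) dvd_refl] by blast
qed

text \<open>No vertex is isolated.\<close>

lemma nbhd_other:
  assumes "u \<in> V"
  obtains w where "w \<in> nbhd u" "w \<noteq> u"
proof -
  have "card {w \<in> V. u \<noteq> w \<and> \<not> coprime u w} > 0"
    using card_neighbours[OF assms] k_pos by simp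
  then have "{w \<in> V. u \<noteq> w \<and> \<not> coprime u w} \<noteq> {}" by (metis card.empty less_irrefl)
  then show thesis using that by (auto simp: nbhd_def)
qed

lemma twins_refl: "twins x x"
  by (simp add: twins_def)

lemma twins_sym: "twins x y \<Longrightarrow> twins y x"
  and twins_trans: "twins x y \<Longrightarrow> twins y z \<Longrightarrow> twins x z"
  by (simp_all add: twins_def)

lemma twins_if_centralizer_subset:
  assumes "x \<in> noncentral" "y \<in> noncentral" "centralizer x \<subseteq> centralizer y"
  shows "twins x y"
proof -
  have "class_size y dvd class_size x"
    using class_size_dvd noncentral_carrier assms by blast
  then have "nbhd (class_size y) = nbhd (class_size x)"
    using nbhd_eq_if_dvd class_size_in_V assms(1,2) by blast
  then show ?thesis by (simp add: twins_def)
qed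

lemma twins_primary_part:
  assumes "x \<in> noncentral"
  obtains p z where "prime p" "p_element p z" "z \<in> noncentral"
    "centralizer x \<subseteq> centralizer z" "twins z x"
proof -
  obtain p z where "prime p" "p_element p z" "z \<in> noncentral" "centralizer x \<subseteq> centralizer z"
    using noncentral_primary_part[OF assms] .
  then show thesis
    using that twins_if_centralizer_subset[OF assms] twins_sym by blast
qed

lemma twins_if_commute:
  assumes "prime p" "prime q" "p \<noteq> q" "p_element p x" "p_element q y"
    and "x \<in> noncentral" "y \<in> noncentral" "y \<in> centralizer x"
  shows "twins x y"
proof -
  have c: "x \<in> carrier G" "y \<in> carrier G" using assms noncentral_carrier by blast+
  have xy: "x \<otimes> y = y \<otimes> x" using assms(8) by (simp add: centralizer_iff)
  have 1: "centralizer (x \<otimes> y) \<subseteq> centralizer x"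
    using centralizer_mult_coprime[of p q x y] assms by blast
  have 2: "centralizer (x \<otimes> y) \<subseteq> centralizer y"
    using centralizer_mult_coprime[of q p y x] assms centralizer_sym[OF c(1)] xy by auto
  have "x \<otimes> y \<in> noncentral"
  proof -
    have "centralizer x \<subset> carrier G"
      using assms noncentral_iff[OF c(1)] by (auto simp: centralizer_iff)
    then show ?thesis using 1 noncentral_iff[of "x \<otimes> y"] c by auto
  qed
  then show ?thesis
    using twins_if_centralizer_subset 1 2 assms twins_sym twins_trans by meson
qed

text \<open>Otherwise \<open>x\<close> commutes with a conjugate of \<open>y\<close>, which is then a twin of \<open>x\<close>.\<close>

lemma prime_dvd_class_size:
  assumes "prime p" "prime q" "p \<noteq> q" "p_element p x" "p_element q y"
    and "x \<in> noncentral" "y \<in> noncentral" "\<not> twins x y"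
  shows "p dvd class_size y"
proof (rule ccontr)
  assume "\<not> p dvd class_size y"
  then obtain y' where y': "y' \<in> conj_class G y" "y' \<in> centralizer x"
    using p_element_commutes_with_conjugate[OF assms(1,4) noncentral_carrier[OF assms(7)]] by blast
  note f = conj_class_memD[OF noncentral_carrier[OF assms(7)] y'(1)]
  have "y' \<in> noncentral"
    using f(1,2) noncentral_iff_class_size noncentral_carrier[OF assms(7)] assms(7) by simp
  then have "twins x y'"
    using twins_if_commute[of p q x y'] assms y'(2) f(3)[OF assms(5)] by blast
  then show False using assms(8) f(2) by (simp add: twins_def)
qed

end

section \<open>Two elements of prime power orders with coprime class sizes\<close>

text \<open>
  The assumptions of this locale turn out to be contradictory (\<open>inconsistent\<close>). They are
  symmetric under exchanging \<open>(p, c)\<close> with \<open>(q, d)\<close>, so that each statement below also yields its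
  mirror image via \<open>swapped\<close>.
\<close>

locale separated_pair = regular_class_graph +
  fixes p q :: nat and c d
  assumes p: "prime p" and q: "prime q" and pq: "p \<noteq> q"
    and c: "c \<in> noncentral" "p_element p c"
    and d: "d \<in> noncentral" "p_element q d"
    and coprime_cd: "coprime (class_size c) (class_size d)"
begin

lemma swapped: "separated_pair G k q p d c"
  using p q pq c d coprime_cd by unfold_locales (auto simp: coprime_commute)

lemma not_twins_cd: "\<not> twins c d"
  using self_in_nbhd[OF class_size_in_V[OF d(1)]] coprime_cd
  unfolding twins_def nbhd_def by blast

lemma p_dvd: "p dvd class_size d"
  using prime_dvd_class_size p q pq c d not_twins_cd by blast

lemma twin_coprime:
  assumes "x \<in> noncentral" "twins x c"
  shows "coprime (class_size x) (class_size d)"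
proof -
  have "class_size d \<notin> nbhd (class_size x)"
    using coprime_cd unfolding assms(2)[unfolded twins_def] unfolding nbhd_def by blast
  then show ?thesis using class_size_in_V[OF d(1)] by (simp add: nbhd_def)
qed

lemma twins_exclusive: "x \<in> noncentral \<Longrightarrow> twins x c \<Longrightarrow> \<not> twins x d"
  using not_twins_cd twins_sym twins_trans by meson

lemma other_prime:
  assumes "prime l" "l \<noteq> p" "l \<noteq> q" "p_element l z" "z \<in> noncentral"
  shows "twins z c \<or> twins z d"
proof (rule ccontr)
  assume "\<not> ?thesis"
  then have "l dvd class_size c" "l dvd class_size d"
    using prime_dvd_class_size assms p q c d by blast+
  then show False using coprime_cd assms(1) coprime_no_common_prime by blast
qed

text \<open>A noncentral element that is a twin neither of \<open>c\<close> nor of \<open>d\<close>.\<close>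

definition stray :: "'a \<Rightarrow> bool" where
  "stray x \<longleftrightarrow> x \<in> noncentral \<and> \<not> twins x c \<and> \<not> twins x d"

text \<open>
  An element of \<open>s\<close>-power order commuting with \<open>x\<close>, where \<open>s\<close> is a third prime, is a twin of
  \<open>c\<close> or \<open>d\<close>, and it is also a twin of \<open>x\<close>: the prime power order part of \<open>x\<close> belongs to
  \<open>p\<close> or \<open>q\<close>.
\<close>

lemma stray_cofactor:
  assumes "stray x" "prime s" "s dvd cofactor x"
  shows "s = p \<or> s = q"
proof (rule ccontr)
  assume s: "\<not> ?thesis"
  have x: "x \<in> noncentral" using assms(1) by (simp add: stray_def)
  obtain z where z: "z \<in> centralizer x" "z \<in> noncentral" "p_element s z"
    using cofactor_p_element[OF assms(2) noncentral_carrier[OF x] assms(3)] .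
  obtain l y where y: "prime l" "p_element l y" "y \<in> noncentral"
    "centralizer x \<subseteq> centralizer y" "twins y x"
    using twins_primary_part[OF x] .
  have ny: "\<not> twins y c" "\<not> twins y d"
    using y(5) assms(1) twins_sym twins_trans unfolding stray_def by meson+
  then have "l = p \<or> l = q" using other_prime y by blast
  then have "twins y z" using twins_if_commute[of l s y z] y z s assms(2) by blast
  then show False using other_prime[of s z] s z assms(2) ny twins_trans by meson
qed

text \<open>
  The closed neighbourhood at \<open>c\<close> is not contained in the one at \<open>x\<close>. A vertex \<open>t\<close> in the
  difference shares a prime \<open>s\<close> with the class size of \<open>c\<close>; as \<open>s\<close> does not divide the class
  size of \<open>x\<close>, it divides the cofactor, so it is \<open>p\<close> or \<open>q\<close>, and \<open>p\<close> is impossible.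
\<close>

lemma stray_witness:
  assumes "stray x"
  obtains t where "t \<in> V" "t \<in> nbhd (class_size c)" "coprime t (class_size x)" "q dvd t"
proof -
  have x: "x \<in> noncentral" "\<not> twins x c" using assms by (simp_all add: stray_def)
  have "\<not> nbhd (class_size c) \<subseteq> nbhd (class_size x)"
    using nbhd_subset_imp_eq[OF class_size_in_V[OF c(1)] class_size_in_V[OF x(1)]] x(2)
    unfolding twins_def by blast
  then obtain t where t: "t \<in> V" "t \<in> nbhd (class_size c)" "coprime t (class_size x)"
    by (auto simp: nbhd_def coprime_commute)
  then have "\<not> coprime t (class_size c)" by (simp add: nbhd_def coprime_commute)
  then obtain s where s: "prime s" "s dvd t" "s dvd class_size c"
    using common_prime_factor by blast
  have "s dvd central_index"
    using s(3) class_size_mult_cofactor[OF noncentral_carrier[OF c(1)]] by (metis dvd_mult2)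
  then have "s dvd class_size x * cofactor x"
    using class_size_mult_cofactor noncentral_carrier x by simp
  moreover have "\<not> s dvd class_size x"
    using t(3) s coprime_no_common_prime by blast
  ultimately have "s = p \<or> s = q"
    using stray_cofactor[OF assms s(1)] s(1) prime_dvd_mult_iff by blast
  moreover have "s \<noteq> p"
    using s(1,3) p_dvd coprime_cd coprime_no_common_prime by blast
  ultimately show thesis using that t s(2) by blast
qed

lemma stray_swap: "separated_pair.stray G d c x = stray x"
  using separated_pair.stray_def[OF swapped] stray_def by blast

lemma stray_class_size_not_q: "stray x \<Longrightarrow> \<not> q dvd class_size x"
  using stray_witness q coprime_no_common_prime by blast

lemma stray_class_size_not_p: "stray x \<Longrightarrow> \<not> p dvd class_size x"
  using separated_pair.stray_class_size_not_q[OF swapped] stray_swap by blast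

text \<open>Hence all stray elements have the same class size.\<close>

lemma stray_class_size_dvd:
  assumes "stray x" "stray y"
  shows "class_size x dvd class_size y"
proof -
  have car: "x \<in> carrier G" "y \<in> carrier G"
    using assms noncentral_carrier by (auto simp: stray_def)
  have "coprime (class_size x) (cofactor y)"
  proof (rule ccontr)
    assume "\<not> ?thesis"
    then obtain s where "prime s" "s dvd class_size x" "s dvd cofactor y"
      using common_prime_factor by blast
    then show False
      using stray_cofactor[OF assms(2)] stray_class_size_not_p stray_class_size_not_q assms(1) by blast
  qed
  moreover have "class_size x dvd class_size y * cofactor y"
    using class_size_mult_cofactor car by (metis dvd_triv_left)
  ultimately show ?thesis by (simp add: coprime_dvd_mult_left_iff)
qed

text \<open>
  The vertex \<open>t\<close> of \<open>stray_witness\<close> can only be the class size of a twin of \<open>c\<close>, and it is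
  coprime to the class size of \<open>x\<close>.
\<close>

lemma stray_not_adjacent:
  assumes "stray x" "y \<in> noncentral" "twins y c"
  shows "coprime (class_size x) (class_size y)"
proof (rule ccontr)
  assume "\<not> ?thesis"
  have x: "x \<in> noncentral" using assms by (simp add: stray_def)
  have "class_size x \<in> nbhd (class_size y)"
    using \<open>\<not> coprime _ _\<close> class_size_in_V[OF x] by (simp add: nbhd_def coprime_commute)
  then have xc: "class_size x \<in> nbhd (class_size c)" using assms(3) unfolding twins_def by blast
  obtain t where t: "t \<in> V" "t \<in> nbhd (class_size c)" "coprime t (class_size x)"
    using stray_witness[OF assms(1)] .
  obtain z where z: "z \<in> noncentral" "t = class_size z"
    using t(1) by (auto simp: V_eq)
  have cz: "class_size c \<in> nbhd (class_size z)"
    using nbhd_sym[OF class_size_in_V[OF c(1)] t(2)] z by simp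
  consider "stray z" | "twins z c" | "twins z d" using z by (auto simp: stray_def)
  then show False
  proof cases
    case 1
    then have "class_size z = class_size x"
      using stray_class_size_dvd assms(1) dvd_antisym by blast
    then show False using t(3) z class_size_noncentral[OF x] by simp
  next
    case 2
    then have "class_size x \<in> nbhd t" using xc z unfolding twins_def by blast
    then show False using t(3) by (simp add: nbhd_def)
  next
    case 3
    then have "class_size c \<in> nbhd (class_size d)" using cz unfolding twins_def by blast
    then show False using coprime_cd by (simp add: nbhd_def coprime_commute)
  qed
qed

lemma no_stray: "\<not> stray x"
proof
  assume stray: "stray x"
  then have x: "x \<in> noncentral" by (simp add: stray_def)
  obtain w where w: "w \<in> nbhd (class_size x)" "w \<noteq> class_size x"
    using nbhd_other[OF class_size_in_V[OF x]] .
  then obtain y where y: "y \<in> noncentral" "w = class_size y"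
    by (auto simp: nbhd_def V_eq)
  have "\<not> stray y"
    using stray_class_size_dvd[OF stray] stray_class_size_dvd[OF _ stray] w y dvd_antisym by blast
  then have "twins y c \<or> twins y d" using y by (simp add: stray_def)
  then have "coprime (class_size x) (class_size y)"
    using stray_not_adjacent[OF stray y(1)] separated_pair.stray_not_adjacent[OF swapped _ y(1)]
      stray_swap stray by blast
  then show False using w y by (simp add: nbhd_def)
qed

lemma dichotomy: "x \<in> noncentral \<Longrightarrow> twins x c \<or> twins x d"
  using no_stray by (auto simp: stray_def)

text \<open>
  A common prime \<open>s\<close> of the class size of \<open>x\<close> and the cofactor of \<open>y\<close> would give a twin of
  \<open>c\<close> of \<open>s\<close>-power order; comparing it with \<open>d\<close>, where \<open>s \<noteq> q\<close>, shows that \<open>s\<close> divides the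
  class size of \<open>d\<close>, which is coprime to that of \<open>x\<close>.
\<close>

lemma twin_class_size_dvd:
  assumes no: "\<And>z. z \<in> noncentral \<Longrightarrow> p_element q z \<Longrightarrow> \<not> twins z c"
    and "x \<in> noncentral" "twins x c" "y \<in> noncentral" "twins y c"
  shows "class_size x dvd class_size y"
proof -
  have "coprime (class_size x) (cofactor y)"
  proof (rule ccontr)
    assume "\<not> ?thesis"
    then obtain s where s: "prime s" "s dvd class_size x" "s dvd cofactor y"
      using common_prime_factor by blast
    obtain z where z: "z \<in> centralizer y" "z \<in> noncentral" "p_element s z"
      using cofactor_p_element[OF s(1) noncentral_carrier[OF assms(4)] s(3)] .
    obtain l v where v: "prime l" "p_element l v" "v \<in> noncentral"
      "centralizer y \<subseteq> centralizer v" "twins v y"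
      using twins_primary_part[OF assms(4)] .
    have vc: "twins v c" using v(5) assms(5) twins_trans by blast
    have "\<exists>g. g \<in> noncentral \<and> p_element s g \<and> twins g c"
    proof (cases "l = s")
      case True
      then show ?thesis using v vc by blast
    next
      case False
      then have "twins v z" using twins_if_commute[of l s v z] v z s(1) by blast
      then show ?thesis using z vc twins_sym twins_trans by meson
    qed
    then obtain g where g: "g \<in> noncentral" "p_element s g" "twins g c" by blast
    then have "s \<noteq> q" using no by blast
    then have "s dvd class_size d"
      using prime_dvd_class_size[of s q g d] s(1) q g d twins_exclusive by blast
    then show False
      using twin_coprime[OF assms(2,3)] s coprime_no_common_prime by blast
  qed
  moreover have "class_size x dvd class_size y * cofactor y"
    using class_size_mult_cofactor noncentral_carrier assms by (metis dvd_triv_left)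
  ultimately show ?thesis by (simp add: coprime_dvd_mult_left_iff)
qed

text \<open>Otherwise all twins of \<open>c\<close> have the same class size, which is then an isolated vertex.\<close>

lemma q_element_twin_c:
  obtains z where "z \<in> noncentral" "p_element q z" "twins z c"
proof (rule ccontr)
  assume "\<not> thesis"
  then have no: "\<And>z. z \<in> noncentral \<Longrightarrow> p_element q z \<Longrightarrow> \<not> twins z c"
    using that by blast
  obtain w where w: "w \<in> nbhd (class_size c)" "w \<noteq> class_size c"
    using nbhd_other[OF class_size_in_V[OF c(1)]] .
  then obtain y where y: "y \<in> noncentral" "w = class_size y"
    by (auto simp: nbhd_def V_eq)
  have "class_size c \<in> nbhd (class_size y)"
    using nbhd_sym[OF class_size_in_V[OF c(1)] w(1)] y by simp
  moreover have "class_size c \<notin> nbhd (class_size d)"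
    using coprime_cd by (simp add: nbhd_def coprime_commute)
  ultimately have "\<not> twins y d" unfolding twins_def by blast
  then have "twins y c" using dichotomy y by blast
  moreover have "twins c c" by (rule twins_refl)
  ultimately have "class_size c = class_size y"
    using twin_class_size_dvd[OF no] c(1) y(1) dvd_antisym by meson
  then show False using w y by simp
qed

lemma inconsistent: False
proof -
  obtain x where x: "x \<in> noncentral" "p_element q x" "twins x c"
    using q_element_twin_c .
  obtain y where y: "y \<in> noncentral" "p_element p y" "twins y d"
    using separated_pair.q_element_twin_c[OF swapped] .
  have "\<not> twins x y"
    using x y not_twins_cd twins_sym twins_trans by meson
  then have "p dvd class_size x"
    using prime_dvd_class_size[of p q y x] p q pq x y twins_sym by blast
  then show False
    using twin_coprime[OF x(1,3)] p_dvd p coprime_no_common_prime by blast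
qed

end

section \<open>Completeness of the graph\<close>

context regular_class_graph begin

lemma class_sizes_not_coprime:
  assumes "u \<in> V" "w \<in> V"
  shows "\<not> coprime u w"
proof
  assume "coprime u w"
  obtain x where x: "x \<in> noncentral" "u = class_size x" using assms by (auto simp: V_eq)
  obtain y where y: "y \<in> noncentral" "w = class_size y" using assms by (auto simp: V_eq)
  obtain p c where c: "prime p" "p_element p c" "c \<in> noncentral" "twins c x"
    using twins_primary_part[OF x(1)] .
  obtain q d where d: "prime q" "p_element q d" "d \<in> noncentral" "twins d y"
    using twins_primary_part[OF y(1)] .
  have coprime_twins: "coprime (class_size g) (class_size h)"
    if "g \<in> noncentral" "h \<in> noncentral" "twins g g'" "twins h h'" "g' \<in> noncentral" "h' \<in> noncentral"
      "coprime (class_size g') (class_size h')" for g h g' h'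
  proof -
    have "class_size h' \<notin> nbhd (class_size g)"
      using that(7) unfolding that(3)[unfolded twins_def] unfolding nbhd_def by blast
    then have "class_size g \<notin> nbhd (class_size h')"
      using nbhd_sym[OF class_size_in_V[OF that(6)]] by blast
    then have "class_size g \<notin> nbhd (class_size h)" using that(4) unfolding twins_def by blast
    then show ?thesis
      using class_size_in_V[OF that(1)] by (simp add: nbhd_def coprime_commute)
  qed
  have cop: "coprime (class_size c) (class_size d)"
    using coprime_twins[of c d x y] c d x y \<open>coprime u w\<close> by blast
  have different: False
    if "prime r" "prime s" "r \<noteq> s" "p_element r g" "p_element s h" "g \<in> noncentral" "h \<in> noncentral"
      "coprime (class_size g) (class_size h)" for r s g h
  proof -
    interpret separated_pair G k r s g h
      by unfold_locales (use that in auto)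
    show False by (rule inconsistent)
  qed
  (* If the two elements belong to the same prime p, which does not divide the first class size,
     then h can be replaced by an element of order a power of a prime l dividing that size. *)
  have same: False
    if prems: "p_element p g" "p_element p h" "g \<in> noncentral" "h \<in> noncentral"
      "coprime (class_size g) (class_size h)" "\<not> p dvd class_size g" for g h
  proof -
    obtain l where l: "prime l" "l dvd class_size g"
      using class_size_noncentral[OF prems(3)] by (metis prime_factor_nat less_irrefl)
    have "l dvd class_size h * cofactor h"
      using l(2) class_size_mult_cofactor prems(3,4) noncentral_carrier by (metis dvd_mult2)
    moreover have "\<not> l dvd class_size h"
      using l prems(5) coprime_no_common_prime by blast
    ultimately have "l dvd cofactor h" using l(1) prime_dvd_mult_iff by blast
    then obtain z where z: "z \<in> centralizer h" "z \<in> noncentral" "p_element l z"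
      using cofactor_p_element[OF l(1) noncentral_carrier[OF prems(4)]] by blast
    have "l \<noteq> p" using l prems(6) by blast
    then have "twins h z" using twins_if_commute[of p l h z] z l prems c(1) by blast
    then have "coprime (class_size g) (class_size z)"
      using coprime_twins[of g z g h] prems z(2) twins_sym twins_refl by blast
    then show False using different[of p l g z] \<open>l \<noteq> p\<close> c(1) l(1) prems z by blast
  qed
  show False
  proof (cases "p = q")
    case False
    then show False using different c d cop by blast
  next
    case True
    have "\<not> p dvd class_size c \<or> \<not> p dvd class_size d"
      using cop c(1) coprime_no_common_prime by blast
    then show False
      using same[of c d] same[of d c] c d cop True by (auto simp: coprime_commute)
  qed
qed

end

theorem mainTheorem1:
  fixes G :: "('a, 'b) monoid_scheme" and k :: nat
  assumes "group G" and "finite (carrier G)" and "k \<ge> 1"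
    and "regular_graph k (with_proj (common_divisor_graph G))"
  shows "complete_digraph (k + 1) (with_proj (common_divisor_graph G))"
proof -
  let ?\<Gamma> = "with_proj (common_divisor_graph G)"
  let ?V = "noncentral_class_sizes G"
  have V: "verts ?\<Gamma> = ?V"
    by (simp add: common_divisor_graph_def)
  have deg: "card {w \<in> ?V. u \<noteq> w \<and> \<not> coprime u w} = k" if "u \<in> ?V" for u
  proof -
    have "out_arcs ?\<Gamma> u = Pair u ` {w \<in> ?V. u \<noteq> w \<and> \<not> coprime u w}"
      using that by (auto simp: out_arcs_def common_divisor_graph_def)
    then have "out_degree ?\<Gamma> u = card {w \<in> ?V. u \<noteq> w \<and> \<not> coprime u w}"
      by (simp add: out_degree_def card_image inj_on_def)
    then show ?thesis using assms(4) that V by (simp add: regular_graph_def)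
  qed
  interpret regular_class_graph G k
    by (intro regular_class_graph.intro finite_group.intro finite_group_axioms.intro
        regular_class_graph_axioms.intro) (use assms deg in auto)
  obtain u where u: "u \<in> ?V" using assms(4) V by (auto simp: regular_graph_def)
  have "nbhd u = ?V" using class_sizes_not_coprime u by (auto simp: nbhd_def)
  then have "card ?V = k + 1" using card_nbhd[OF u] by simp
  then show ?thesis
    using finite_V class_sizes_not_coprime
    by (auto simp: complete_digraph_pair_def common_divisor_graph_def)
qed

end
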